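(* Let $n \in \mathbb{Z}_{\geq 1}$, $t > 0$, $\vec{x} = (x_1 < \cdots < x_n) \in \mathbb{R}^n$ and $\vec{m} = (m_1, \ldots, m_n) \in \mathbb{Z}_{\geq 1}^n$. Let $M:=\sum_{i=1}^n m_i$ and, for $k\in\{1,\ldots,M\}$, let $f(k):=j$ and $u_k := x_j$ where $j$ is the index with $\sum_{i=1}^{j-1} m_i < k \leq \sum_{i=1}^{j} m_i$. Then the infimum $$\inf\Big\{\sum_{i=1}^{M}\frac t2a_i^2+\sum_{i=1}^{M}u_ia_i : a_1,\ldots,a_M\in\mathbb{R},\ a_i-a_{i+1}\geq1,\ i=1,\ldots,M-1\Big\}$$ has a unique minimizer $(a_1^*,\ldots,a_M^* )$. Moreover, for $i\in\{1,\ldots,M-1\}$: if there exists $j\in\{1,\ldots,\mathfrak{n}\}$ such that $f(i),f(i+1)\in\mathfrak{b}_j$, then $a_i^*-a_{i+1}^*=1$; if there does not exist such $j$, then $a_i^*-a_{i+1}^*>1$. Here $\mathfrak{b}_1,\ldots,\mathfrak{b}_{\mathfrak{n}}$ is the partition of $\{1,\ldots,n\}$ determined by the inertia clusters started from $(\vec x,\vec m)$ on $[0,t]$.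
   Context: Inertia clusters started from $(\vec x,\vec m)$ on the time interval $[0,t]$: at time $s=0$ there are $n$ point masses, the $i$-th with weight $m_i$ at location $x_i$. The $i$-th mass travels on the line with constant velocity $\phi_i := \frac12(m_{i+1}+\cdots+m_n) - \frac12(m_1+\cdots+m_{i-1})$ until a collision. Whenever point masses (possibly themselves results of earlier mergers) collide, they merge into a single point mass whose weight is the sum of their weights and whose velocity is the weighted average (by weight) of their velocities just before collision (conservation of momentum). Let $\zeta_i(s)$, $s\in[0,t]$, be the position at time $s$ of the point mass containing the $i$-th initial one. Let $\mathfrak{n}$ be the number of distinct clusters at time $t$ (distinct values among $\zeta_1(t),\ldots,\zeta_n(t)$), and let $\mathfrak{b}_1,\ldots,\mathfrak{b}_{\mathfrak{n}}$ be the partition of $\{1,\ldots,n\}$ in which $i,j$ are in the same block iff $\zeta_i(t)=\zeta_j(t)$ (i.e. they have merged during $[0,t]$), ordered so that for $i<j$ all elements of $\mathfrak{b}_i$ are smaller than those of $\mathfrak{b}_j$. *)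

theory Defs
  imports Complex_Main "HOL-Library.FuncSet"
begin

text \<open>
  A point mass carries the set of indices of the initial point masses that it consists of.
\<close>

record point_mass =
  labels :: "nat set"
  weight :: real
  loc :: real
  vel :: real

definition travel :: "real \<Rightarrow> point_mass \<Rightarrow> point_mass" where
  "travel s p = p\<lparr>loc := loc p + s * vel p\<rparr>"

text \<open>
  The single point mass produced when all members of \<open>C\<close> meet at the point \<open>y\<close>;
  its velocity is given by conservation of momentum.
\<close>

definition merge :: "real \<Rightarrow> point_mass set \<Rightarrow> point_mass" where
  "merge y C =
    \<lparr>labels = (\<Union>p\<in>C. labels p),
     weight = (\<Sum>p\<in>C. weight p),
     loc = y,
     vel = (\<Sum>p\<in>C. weight p * vel p) / (\<Sum>p\<in>C. weight p)\<rparr>"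

definition merge_collided :: "point_mass set \<Rightarrow> point_mass set" where
  "merge_collided S = (\<lambda>y. merge y {p \<in> S. loc p = y}) ` loc ` S"

definition collision_times :: "point_mass set \<Rightarrow> real \<Rightarrow> real set" where
  "collision_times S s =
    {r. 0 < r \<and> r \<le> s \<and> (\<exists>p\<in>S. \<exists>q\<in>S. p \<noteq> q \<and> loc (travel r p) = loc (travel r q))}"

lemma card_merge_collided_less:
  assumes S: "finite S" and r: "r \<in> collision_times S s"
  shows "card (merge_collided (travel r ` S)) < card S"
proof -
  have "card (merge_collided (travel r ` S)) \<le> card (loc ` travel r ` S)"
    unfolding merge_collided_def using S by (intro card_image_le) auto
  also have "\<dots> = card ((\<lambda>p. loc (travel r p)) ` S)"
    by (simp add: image_image)
  also have "\<dots> < card S"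
  proof -
    have "\<not> inj_on (\<lambda>p. loc (travel r p)) S"
      using r by (auto simp: collision_times_def inj_on_def)
    then show ?thesis
      using S by (meson card_image_le inj_on_iff_eq_card le_neq_implies_less)
  qed
  finally show ?thesis .
qed

text \<open>
  The system reached from \<open>S\<close> after time \<open>s\<close>: travel freely up to the first collision time,
  merge all point masses that have met (possibly at several places), and continue from there.
  The two finiteness conditions only serve to make the recursion terminate: they hold for every
  finite system of point masses at pairwise distinct locations, and merging preserves both
  properties.
\<close>

function evolve :: "point_mass set \<Rightarrow> real \<Rightarrow> point_mass set" where
  "evolve S s =
    (if finite S \<and> finite (collision_times S s) \<and> collision_times S s \<noteq> {}
     then evolve (merge_collided (travel (Min (collision_times S s)) ` S))
                 (s - Min (collision_times S s))
     else travel s ` S)"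
  by pat_completeness auto
termination
  by (relation "Wellfounded.measure (\<lambda>(S, s). card S)")
     (auto intro!: card_merge_collided_less Min_in)

declare evolve.simps [simp del]

definition initial_velocity :: "nat \<Rightarrow> (nat \<Rightarrow> nat) \<Rightarrow> nat \<Rightarrow> real" where
  "initial_velocity n m i =
    1/2 * (\<Sum>j\<in>{i+1..n}. real (m j)) - 1/2 * (\<Sum>j\<in>{1..<i}. real (m j))"

definition initial_system :: "nat \<Rightarrow> (nat \<Rightarrow> real) \<Rightarrow> (nat \<Rightarrow> nat) \<Rightarrow> point_mass set" where
  "initial_system n x m =
    (\<lambda>i. \<lparr>labels = {i}, weight = real (m i), loc = x i, vel = initial_velocity n m i\<rparr>) ` {1..n}"

definition inertia_position ::
    "nat \<Rightarrow> (nat \<Rightarrow> real) \<Rightarrow> (nat \<Rightarrow> nat) \<Rightarrow> nat \<Rightarrow> real \<Rightarrow> real" where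
  "inertia_position n x m i s =
    loc (THE p. p \<in> evolve (initial_system n x m) s \<and> i \<in> labels p)"

definition num_clusters :: "nat \<Rightarrow> (nat \<Rightarrow> real) \<Rightarrow> (nat \<Rightarrow> nat) \<Rightarrow> real \<Rightarrow> nat" where
  "num_clusters n x m t = card ((\<lambda>i. inertia_position n x m i t) ` {1..n})"

definition cluster_partition ::
    "nat \<Rightarrow> (nat \<Rightarrow> real) \<Rightarrow> (nat \<Rightarrow> nat) \<Rightarrow> real \<Rightarrow> nat set set" where
  "cluster_partition n x m t =
    {1..n} // {(i, j) \<in> {1..n} \<times> {1..n}. inertia_position n x m i t = inertia_position n x m j t}"

text \<open>The blocks in increasing order; list positions count from 0, block indices from 1.\<close>

definition cluster_blocks ::
    "nat \<Rightarrow> (nat \<Rightarrow> real) \<Rightarrow> (nat \<Rightarrow> nat) \<Rightarrow> real \<Rightarrow> nat set list" where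
  "cluster_blocks n x m t =
    (THE bs. set bs = cluster_partition n x m t \<and>
             sorted_wrt (\<lambda>A B. \<forall>i\<in>A. \<forall>j\<in>B. i < j) bs)"

definition cluster_block ::
    "nat \<Rightarrow> (nat \<Rightarrow> real) \<Rightarrow> (nat \<Rightarrow> nat) \<Rightarrow> real \<Rightarrow> nat \<Rightarrow> nat set" where
  "cluster_block n x m t j = cluster_blocks n x m t ! (j - 1)"

definition mass_index :: "nat \<Rightarrow> (nat \<Rightarrow> nat) \<Rightarrow> nat \<Rightarrow> nat" where
  "mass_index n m k =
    (THE j. j \<in> {1..n} \<and> (\<Sum>l\<in>{1..<j}. m l) < k \<and> k \<le> (\<Sum>l\<in>{1..j}. m l))"

text \<open>
  Real vectors of length \<open>M\<close> are functions on the index set \<open>{1..M}\<close>, undefined elsewhere,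
  so that uniqueness of a minimizer is meaningful.
\<close>

definition feasible :: "nat \<Rightarrow> (nat \<Rightarrow> real) set" where
  "feasible M = {a \<in> {1..M} \<rightarrow>\<^sub>E UNIV. \<forall>i\<in>{1..<M}. a i - a (i + 1) \<ge> 1}"

definition objective :: "nat \<Rightarrow> real \<Rightarrow> (nat \<Rightarrow> real) \<Rightarrow> (nat \<Rightarrow> real) \<Rightarrow> real" where
  "objective M t u a = (\<Sum>i=1..M. t / 2 * (a i)\<^sup>2) + (\<Sum>i=1..M. u i * a i)"

end

theory Submission imports Defs
begin

text \<open>
  Write \<open>z i\<close> for the position at time \<open>t\<close> of the cluster containing the \<open>i\<close>-th mass. The minimizer
  is \<open>a k = (M + 1) / 2 - k - z (f k) / t\<close>, so that \<open>a k - a (k + 1) = 1 + (z (f (k + 1)) - z (f k)) / t\<close>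
  and the constraint is tight exactly inside clusters. Its optimality is the barycentre property
  of sticky particles: comparing the clusters with the free flow \<open>x i + t * \<phi> i\<close>, the sums
  \<open>\<Sum>i\<le>j. m i * (x i + t * \<phi> i - z i)\<close> are nonnegative, and vanish if \<open>j\<close> is the last member of its
  cluster. Between collisions these sums do not decrease because \<open>\<phi>\<close> decreases in \<open>i\<close>; at a
  collision no position jumps and cluster ends only disappear, so nothing has to be checked there. Summing
  over the \<open>m i\<close> unit masses turns them into partial sums of the gradient of the objective,
  which are the Lagrange multipliers of the constraints.
\<close>

section \<open>Prefix sums, and merging without collisions\<close>

text \<open>By \<open>sign\<close>, once \<open>g\<close> is negative on \<open>{a<..b}\<close> it
  stays negative. So the prefix sums rise and then fall between \<open>a\<close> and
  \<open>b\<close>, and never drop below the smaller end value.\<close>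

lemma unimodal_prefix_sum_nonneg:
  fixes g :: "nat \<Rightarrow> real"
  assumes j: "a \<le> j" "j \<le> b"
    and sign: "\<And>i k. \<lbrakk>a < i; i \<le> k; k \<le> b; 0 \<le> g k\<rbrakk> \<Longrightarrow> 0 \<le> g i"
    and ends: "0 \<le> (\<Sum>i=1..a. g i)" "0 \<le> (\<Sum>i=1..b. g i)"
  shows "0 \<le> (\<Sum>i=1..j. g i)"
proof (cases "j = a")
  case False
  show ?thesis
  proof (cases "0 \<le> g j")
    case True
    have "{1..j} = {1..a} \<union> {a<..j}" using j by auto
    then have "(\<Sum>i=1..j. g i) = (\<Sum>i=1..a. g i) + (\<Sum>i\<in>{a<..j}. g i)"
      by (metis finite_atLeastAtMost finite_greaterThanAtMost ivl_disj_int_two(8) sum.union_disjoint)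
    moreover have "0 \<le> (\<Sum>i\<in>{a<..j}. g i)"
      using True j by (intro sum_nonneg) (auto intro: sign[of _ j])
    ultimately show ?thesis using ends by simp
  next
    case neg: False
    have "{1..b} = {1..j} \<union> {j<..b}" using j by auto
    then have "(\<Sum>i=1..b. g i) = (\<Sum>i=1..j. g i) + (\<Sum>i\<in>{j<..b}. g i)"
      by (metis finite_atLeastAtMost finite_greaterThanAtMost ivl_disj_int_two(8) sum.union_disjoint)
    moreover have "(\<Sum>i\<in>{j<..b}. g i) \<le> 0"
    proof (intro sum_nonpos)
      fix k assume "k \<in> {j<..b}"
      then show "g k \<le> 0" using neg j False sign[of j k] by fastforce
    qed
    ultimately show ?thesis using ends by simp
  qed
qed (use ends in simp)

text \<open>Abel summation: it pairs the gradient of the objective with a displacement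
  \<open>d\<close> through the differences that the constraints control.\<close>

lemma summation_by_parts_Suc:
  fixes g d :: "nat \<Rightarrow> real"
  shows "(\<Sum>k=1..Suc M. g k * d k) =
    (\<Sum>k=1..M. (\<Sum>l=1..k. g l) * (d k - d (Suc k))) + (\<Sum>l=1..Suc M. g l) * d (Suc M)"
  by (induction M) (simp_all add: algebra_simps)

lemma merge_singleton: "weight p \<noteq> 0 \<Longrightarrow> merge (loc p) {p} = p"
  by (simp add: merge_def)

text \<open>Free travel without a collision thus counts as a merging step with singleton
  groups.\<close>

lemma merge_collided_inj:
  assumes "inj_on loc S" "\<And>p. p \<in> S \<Longrightarrow> weight p \<noteq> 0"
  shows "merge_collided S = S"
proof -
  have "merge (loc p) {q \<in> S. loc q = loc p} = p" if "p \<in> S" for p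
  proof -
    have "{q \<in> S. loc q = loc p} = {p}" using assms(1) that by (auto simp: inj_on_def)
    then show ?thesis using assms(2)[OF that] by (simp add: merge_singleton)
  qed
  then show ?thesis by (simp add: merge_collided_def image_image)
qed

section \<open>The barycentre property of inertia clusters\<close>

locale inertia_clusters =
  fixes n :: nat and w \<phi> x :: "nat \<Rightarrow> real"
  assumes w_pos: "i \<in> {1..n} \<Longrightarrow> 0 < w i"
    and \<phi>_antimono: "\<lbrakk>1 \<le> i; i \<le> j; j \<le> n\<rbrakk> \<Longrightarrow> \<phi> j \<le> \<phi> i"
begin

text \<open>
  A configuration is encoded by the position \<open>z i\<close> of the cluster of each initial mass; the
  clusters are the level sets of \<open>z\<close>.
\<close>

definition level :: "(nat \<Rightarrow> real) \<Rightarrow> real \<Rightarrow> nat set" where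
  "level z y = {i \<in> {1..n}. z i = y}"

text \<open>Momentum is conserved in every merger, so the velocity depends only on the members of a
  cluster, not on the history of their mergers.\<close>

definition velocity :: "(nat \<Rightarrow> real) \<Rightarrow> real \<Rightarrow> real" where
  "velocity z y = (\<Sum>i\<in>level z y. w i * \<phi> i) / (\<Sum>i\<in>level z y. w i)"

definition cluster :: "(nat \<Rightarrow> real) \<Rightarrow> real \<Rightarrow> point_mass" where
  "cluster z y =
    \<lparr>labels = level z y, weight = (\<Sum>i\<in>level z y. w i), loc = y, vel = velocity z y\<rparr>"

definition system :: "(nat \<Rightarrow> real) \<Rightarrow> point_mass set" where
  "system z = cluster z ` z ` {1..n}"

text \<open>Clusters that meet acquire equal values, so merging needs no separate operation on
  configurations.\<close>

definition drift :: "real \<Rightarrow> (nat \<Rightarrow> real) \<Rightarrow> nat \<Rightarrow> real" where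
  "drift s z i = z i + s * velocity z (z i)"

text \<open>0 counts as an end, so that the first cluster also lies between two consecutive
  ends.\<close>

definition cluster_end :: "(nat \<Rightarrow> real) \<Rightarrow> nat \<Rightarrow> bool" where
  "cluster_end z j \<longleftrightarrow> j = 0 \<or> j = n \<or> j < n \<and> z j < z (Suc j)"

definition barycentric :: "real \<Rightarrow> (nat \<Rightarrow> real) \<Rightarrow> bool" where
  "barycentric r z \<longleftrightarrow> mono_on {1..n} z \<and>
    (\<forall>j\<le>n. 0 \<le> (\<Sum>i=1..j. w i * (x i + r * \<phi> i - z i)) \<and>
      (cluster_end z j \<longrightarrow> (\<Sum>i=1..j. w i * (x i + r * \<phi> i - z i)) = 0))"

section \<open>Momentum of clusters and of their initial parts\<close>

lemma level_weight_pos: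
  assumes "y \<in> z ` {1..n}"
  shows "0 < (\<Sum>i\<in>level z y. w i)"
  using assms by (intro sum_pos) (auto simp: level_def intro: w_pos)

lemma level_momentum:
  assumes "y \<in> z ` {1..n}"
  shows "(\<Sum>i\<in>level z y. w i) * velocity z y = (\<Sum>i\<in>level z y. w i * \<phi> i)"
  using level_weight_pos[OF assms] by (simp add: velocity_def)

lemma sum_levels:
  assumes "Y \<subseteq> z ` {1..n}"
  shows "(\<Sum>y\<in>Y. \<Sum>i\<in>level z y. h i) = (\<Sum>i | i \<in> {1..n} \<and> z i \<in> Y. (h i :: real))"
proof -
  have "finite Y" using assms finite_surj by blast
  then have "(\<Sum>y\<in>Y. \<Sum>i\<in>level z y. h i) = (\<Sum>i\<in>(\<Union>y\<in>Y. level z y). h i)"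
    by (intro sum.UNION_disjoint[symmetric]) (auto simp: level_def)
  also have "(\<Union>y\<in>Y. level z y) = {i. i \<in> {1..n} \<and> z i \<in> Y}"
    by (auto simp: level_def)
  finally show ?thesis .
qed

text \<open>The velocity of a cluster is the weighted mean of the \<open>\<phi> i\<close> of its
  members, so the deviations cancel on each level and hence on any union of levels.\<close>

lemma momentum_of_levels:
  "(\<Sum>i | i \<in> {1..n} \<and> z i \<in> Y. w i * (\<phi> i - velocity z (z i))) = 0"
proof -
  let ?Y = "Y \<inter> z ` {1..n}"
  have "(\<Sum>i | i \<in> {1..n} \<and> z i \<in> Y. w i * (\<phi> i - velocity z (z i))) =
      (\<Sum>i | i \<in> {1..n} \<and> z i \<in> ?Y. w i * (\<phi> i - velocity z (z i)))"
    by (rule sum.cong) auto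
  also have "\<dots> = (\<Sum>y\<in>?Y. \<Sum>i\<in>level z y. w i * (\<phi> i - velocity z (z i)))"
    by (simp add: sum_levels)
  also have "\<dots> = (\<Sum>y\<in>?Y. \<Sum>i\<in>level z y. w i * (\<phi> i - velocity z y))"
    by (intro sum.cong refl) (auto simp: level_def)
  also have "\<dots> = 0"
  proof (rule sum.neutral, rule ballI)
    fix y assume "y \<in> ?Y"
    then show "(\<Sum>i\<in>level z y. w i * (\<phi> i - velocity z y)) = 0"
      using level_momentum[of y z]
      by (simp add: right_diff_distrib sum_subtractf flip: sum_distrib_right)
  qed
  finally show ?thesis .
qed

text \<open>Up to a cluster end, \<open>{1..j}\<close> consists of whole levels, namely those with
  value at most \<open>z j\<close>.\<close>

lemma momentum_at_cluster_end:
  assumes "mono_on {1..n} z" "j \<le> n" "cluster_end z j"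
  shows "(\<Sum>i=1..j. w i * (\<phi> i - velocity z (z i))) = 0"
proof (cases "j = 0")
  case False
  have up: "z i \<le> z j" if "i \<in> {1..j}" for i
    using that False assms by (intro mono_onD[OF assms(1)]) auto
  have down: "i \<le> j" if "i \<in> {1..n}" "z i \<le> z j" for i
  proof (rule ccontr)
    assume "\<not> i \<le> j"
    then have "z (Suc j) \<le> z i" using that by (intro mono_onD[OF assms(1)]) auto
    moreover have "z j < z (Suc j)"
      using \<open>\<not> i \<le> j\<close> that(1) False assms(3) by (auto simp: cluster_end_def)
    ultimately show False using that(2) by linarith
  qed
  have "i \<in> {1..j} \<longleftrightarrow> i \<in> {1..n} \<and> z i \<in> {..z j}" for i
    using up[of i] down[of i] assms(2) by auto
  then have "{1..j} = {i. i \<in> {1..n} \<and> z i \<in> {..z j}}" by blast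
  then show ?thesis by (simp only: momentum_of_levels)
qed simp

text \<open>Take the nearest ends on both sides of \<open>j\<close>: no end lies strictly between
  them, so \<open>z\<close> is constant on \<open>{a<..b}\<close>. If \<open>j\<close> is itself an
  end, then \<open>a = b = j\<close> and this block is empty.\<close>

lemma enclosing_cluster:
  assumes "mono_on {1..n} z" "j \<le> n"
  obtains a b where "a \<le> j" "j \<le> b" "b \<le> n" "cluster_end z a" "cluster_end z b"
    "\<And>i k. \<lbrakk>a < i; i \<le> b; a < k; k \<le> b\<rbrakk> \<Longrightarrow> z i = z k"
proof -
  define a where "a = (GREATEST a. a \<le> j \<and> cluster_end z a)"
  define b where "b = (LEAST b. j \<le> b \<and> cluster_end z b)"
  have a: "a \<le> j \<and> cluster_end z a" unfolding a_def
    by (rule GreatestI_nat[where k = 0 and b = j]) (auto simp: cluster_end_def)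
  have b: "j \<le> b \<and> cluster_end z b" unfolding b_def
    by (rule LeastI[where k = n]) (use assms in \<open>auto simp: cluster_end_def\<close>)
  have bn: "b \<le> n" unfolding b_def
    by (rule Least_le) (use assms in \<open>auto simp: cluster_end_def\<close>)
  have no_end: "\<not> cluster_end z c" if "a < c" "c < b" for c
  proof
    assume c: "cluster_end z c"
    show False
    proof (cases "c \<le> j")
      case True
      then have "c \<le> a" unfolding a_def using c
        by (intro Greatest_le_nat[where b = j]) auto
      then show False using that by simp
    next
      case False
      then have "b \<le> c" unfolding b_def using c by (intro Least_le) auto
      then show False using that by simp
    qed
  qed
  have step: "z (Suc c) = z c" if "a < c" "c < b" for c
    using no_end[OF that] that bn mono_onD[OF assms(1), of c "Suc c"]
    by (auto simp: cluster_end_def)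
  have const: "i \<le> b \<Longrightarrow> z i = z (Suc a)" if "a < i" for i
    using that[unfolded Suc_le_eq[symmetric]]
    by (induction rule: dec_induct) (use step in auto)
  show ?thesis
  proof (rule that[of a b])
    show "z i = z k" if "a < i" "i \<le> b" "a < k" "k \<le> b" for i k
      using const[of i] const[of k] that by argo
  qed (use a b bn in auto)
qed

text \<open>Within a cluster \<open>\<phi>\<close> decreases, so every initial part of it is at least as fast as the whole.\<close>

lemma prefix_momentum_nonneg:
  assumes z: "mono_on {1..n} z" and j: "j \<le> n"
  shows "0 \<le> (\<Sum>i=1..j. w i * (\<phi> i - velocity z (z i)))"
proof -
  obtain a b where ab: "a \<le> j" "j \<le> b" "b \<le> n" "cluster_end z a" "cluster_end z b"
    "\<And>i k. \<lbrakk>a < i; i \<le> b; a < k; k \<le> b\<rbrakk> \<Longrightarrow> z i = z k"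
    using enclosing_cluster[OF assms] by blast
  show ?thesis
  proof (rule unimodal_prefix_sum_nonneg[OF ab(1,2)])
    fix i k assume ik: "a < i" "i \<le> k" "k \<le> b" "0 \<le> w k * (\<phi> k - velocity z (z k))"
    have "z i = z k" using ab(6)[of i k] ik by simp
    moreover have "0 < w i" "0 < w k" using ik(1-3) ab(3) by (auto intro: w_pos)
    moreover have "\<phi> k \<le> \<phi> i" using ik(1-3) ab(3) by (intro \<phi>_antimono) auto
    ultimately show "0 \<le> w i * (\<phi> i - velocity z (z i))"
      using ik(4) by (simp add: zero_le_mult_iff)
  qed (use ab(1-5) momentum_at_cluster_end[OF z, of a] momentum_at_cluster_end[OF z, of b] in auto)
qed

text \<open>The prefix sums grow linearly in \<open>s\<close>, with slope the momentum excess of the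
  prefix; it is nonnegative, and zero at ends of \<open>z\<close>. Members with equal
  \<open>z\<close> share a velocity, so \<open>drift\<close> splits no cluster and every new end is
  an old one.\<close>

lemma barycentric_drift:
  assumes bar: "barycentric r z" and s: "0 \<le> s" and mono: "mono_on {1..n} (drift s z)"
  shows "barycentric (r + s) (drift s z)"
proof -
  have z: "mono_on {1..n} z" using bar by (simp add: barycentric_def)
  have split: "(\<Sum>i=1..j. w i * (x i + (r + s) * \<phi> i - drift s z i)) =
      (\<Sum>i=1..j. w i * (x i + r * \<phi> i - z i)) + s * (\<Sum>i=1..j. w i * (\<phi> i - velocity z (z i)))" for j
    by (simp add: drift_def sum_distrib_left algebra_simps flip: sum.distrib)
  have "cluster_end z j" if "cluster_end (drift s z) j" for j
  proof -
    have "z j < z (Suc j)" if "drift s z j < drift s z (Suc j)" "0 < j" "j < n"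
      using that mono_onD[OF z, of j "Suc j"] by (cases "z j = z (Suc j)") (auto simp: drift_def)
    then show ?thesis using that by (auto simp: cluster_end_def)
  qed
  then show ?thesis
    using bar mono s momentum_at_cluster_end[OF z] prefix_momentum_nonneg[OF z]
    unfolding barycentric_def split by (auto intro!: add_nonneg_nonneg mult_nonneg_nonneg)
qed

section \<open>Point masses versus configurations\<close>

lemma cluster_simps [simp]:
  "labels (cluster z y) = level z y"
  "weight (cluster z y) = (\<Sum>i\<in>level z y. w i)"
  "loc (cluster z y) = y"
  "vel (cluster z y) = velocity z y"
  by (simp_all add: cluster_def)

lemma finite_system [simp]: "finite (system z)"
  by (simp add: system_def)

lemma the_cluster:
  assumes "i \<in> {1..n}"
  shows "(THE p. p \<in> system z \<and> i \<in> labels p) = cluster z (z i)"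
  using assms by (intro the_equality) (auto simp: system_def level_def)

text \<open>Labels keep point masses apart even when they meet; otherwise the set image could
  identify two of them and lose weight before the merger.\<close>

lemma inj_on_travel_cluster: "inj_on (\<lambda>y. travel s (cluster z y)) (z ` {1..n})"
proof (rule inj_onI)
  fix y y' assume y: "y \<in> z ` {1..n}"
    and eq: "travel s (cluster z y) = travel s (cluster z y')"
  have "labels (travel s p) = labels p" for p by (simp add: travel_def)
  with eq have "level z y = level z y'" by (metis cluster_simps(1))
  moreover obtain i where "i \<in> level z y" using y by (auto simp: level_def)
  ultimately show "y = y'" by (metis (mono_tags, lifting) level_def mem_Collect_eq)
qed

text \<open>Labels, weight and momentum are all additive over the levels that drift to
  \<open>y'\<close>, so the merged velocity is again the mean of the initial velocities.\<close>

lemma merge_clusters: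
  assumes "y' \<in> drift s z ` {1..n}"
  shows "merge y' {p \<in> travel s ` system z. loc p = y'} = cluster (drift s z) y'"
proof -
  define F where "F y = travel s (cluster z y)" for y
  have F: "labels (F y) = level z y" "weight (F y) = (\<Sum>i\<in>level z y. w i)"
    "loc (F y) = y + s * velocity z y" "vel (F y) = velocity z y" for y
    by (simp_all add: F_def travel_def)
  define Y where "Y = {y \<in> z ` {1..n}. loc (F y) = y'}"
  have "travel s ` system z = F ` z ` {1..n}"
    by (simp add: system_def image_image F_def)
  moreover have "{p \<in> F ` A. loc p = y'} = F ` {y \<in> A. loc (F y) = y'}" for A by blast
  ultimately have members: "{p \<in> travel s ` system z. loc p = y'} = F ` Y"
    by (simp only: Y_def)
  have sub: "Y \<subseteq> z ` {1..n}" unfolding Y_def by blast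
  have inj: "inj_on F Y"
    using inj_on_subset[OF inj_on_travel_cluster sub] by (simp add: F_def[abs_def])
  have level: "{i. i \<in> {1..n} \<and> z i \<in> Y} = level (drift s z) y'"
    by (simp add: level_def Y_def drift_def F cong: conj_cong)
  have "(\<Union>y\<in>Y. level z y) = level (drift s z) y'"
    unfolding level[symmetric] by (auto simp: level_def)
  moreover have "(\<Sum>y\<in>Y. \<Sum>i\<in>level z y. w i) = (\<Sum>i\<in>level (drift s z) y'. w i)"
    by (simp only: sum_levels[OF sub] level)
  moreover have "(\<Sum>y\<in>Y. (\<Sum>i\<in>level z y. w i) * velocity z y) =
      (\<Sum>i\<in>level (drift s z) y'. w i * \<phi> i)"
  proof -
    have "(\<Sum>y\<in>Y. (\<Sum>i\<in>level z y. w i) * velocity z y) = (\<Sum>y\<in>Y. \<Sum>i\<in>level z y. w i * \<phi> i)"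
      using sub by (intro sum.cong refl level_momentum) auto
    then show ?thesis by (simp only: sum_levels[OF sub] level)
  qed
  ultimately show ?thesis
    unfolding members merge_def cluster_def velocity_def[of "drift s z"]
    by (simp add: sum.reindex[OF inj] F image_image)
qed

lemma loc_travel_system: "loc ` travel s ` system z = drift s z ` {1..n}"
  by (simp add: system_def image_image travel_def drift_def)

lemma merge_collided_travel: "merge_collided (travel s ` system z) = system (drift s z)"
  unfolding merge_collided_def loc_travel_system system_def[of "drift s z"]
  by (intro image_cong refl merge_clusters)

lemma system_ne_iff:
  assumes "p \<in> system z" "q \<in> system z"
  shows "p \<noteq> q \<longleftrightarrow> loc p \<noteq> loc q"
  using assms by (auto simp: system_def)

text \<open>Without collisions the locations stay distinct, so merging changes nothing and
  \<open>merge_collided_travel\<close> applies.\<close>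

lemma travel_system:
  assumes "0 \<le> s" "collision_times (system z) s = {}"
  shows "travel s ` system z = system (drift s z)"
proof -
  have "inj_on loc (travel s ` system z)"
  proof (cases "s = 0")
    \<comment> \<open>Collision times are positive and so say nothing about \<open>s = 0\<close>;
      there distinctness holds because a system has one cluster per location.\<close>
    case True
    then show ?thesis by (auto simp: inj_on_def travel_def system_def)
  next
    case False
    then show ?thesis using assms by (force simp: collision_times_def inj_on_def)
  qed
  moreover have "weight p \<noteq> 0" if "p \<in> travel s ` system z" for p
  proof -
    obtain y where "y \<in> z ` {1..n}" "p = travel s (cluster z y)"
      using \<open>p \<in> travel s ` system z\<close> unfolding system_def by blast
    then show ?thesis using level_weight_pos[of y z] by (simp add: travel_def)
  qed
  ultimately show ?thesis by (metis merge_collided_inj merge_collided_travel)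
qed

text \<open>Distinct point masses start at distinct places, so each pair meets at most once. This
  discharges the finiteness test in \<open>evolve\<close>.\<close>

lemma finite_collision_times: "finite (collision_times (system z) s)"
proof (rule finite_subset)
  show "collision_times (system z) s \<subseteq>
      (\<lambda>(p, q). (loc q - loc p) / (vel p - vel q)) ` (system z \<times> system z)"
  proof
    fix r assume "r \<in> collision_times (system z) s"
    then obtain p q where pq: "p \<in> system z" "q \<in> system z" "p \<noteq> q"
      "loc p + r * vel p = loc q + r * vel q"
      by (auto simp: collision_times_def travel_def)
    have "vel p \<noteq> vel q" using pq system_ne_iff by auto
    then have "r = (loc q - loc p) / (vel p - vel q)"
      using pq(4) by (simp add: field_simps)
    then show "r \<in> (\<lambda>(p, q). (loc q - loc p) / (vel p - vel q)) ` (system z \<times> system z)"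
      using pq by force
  qed
qed simp

text \<open>Two clusters in reversed order at time \<open>s\<close> must have met strictly earlier.
  A collision at \<open>s\<close> itself is allowed, since travel goes up to the first
  collision.\<close>

lemma mono_drift:
  assumes z: "mono_on {1..n} z" and s: "0 \<le> s"
    and first: "\<And>r. r < s \<Longrightarrow> r \<notin> collision_times (system z) s"
  shows "mono_on {1..n} (drift s z)"
proof (rule mono_onI, rule ccontr)
  fix i j assume ij: "i \<in> {1..n}" "j \<in> {1..n}" "i \<le> j" and "\<not> drift s z i \<le> drift s z j"
  define V where "V = velocity z (z i) - velocity z (z j)"
  have gt: "z j - z i < s * V"
    using \<open>\<not> drift s z i \<le> drift s z j\<close> by (simp add: V_def drift_def algebra_simps)
  have le: "z i \<le> z j" using z ij by (auto simp: mono_on_def)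
  then have "z i < z j" using gt by (cases "z i = z j") (auto simp: V_def)
  then have "0 < s * V" using gt by linarith
  then have V: "0 < V" using s by (simp add: zero_less_mult_iff)
  \<comment> \<open>The time at which the gap closes at relative speed \<open>V\<close>.\<close>
  define r where "r = (z j - z i) / V"
  have r: "0 < r" "r < s" using V gt \<open>z i < z j\<close> by (simp_all add: r_def field_simps)
  have meet: "z i + r * velocity z (z i) = z j + r * velocity z (z j)"
  proof -
    have "r * V = z j - z i" using V by (simp add: r_def)
    then show ?thesis by (simp add: V_def algebra_simps)
  qed
  have "r \<in> collision_times (system z) s"
  proof -
    have "cluster z (z i) \<in> system z" "cluster z (z j) \<in> system z"
      using ij by (auto simp: system_def)
    moreover have "cluster z (z i) \<noteq> cluster z (z j)"
      using \<open>z i < z j\<close> by (metis cluster_simps(3) less_irrefl)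
    moreover have "loc (travel r (cluster z (z i))) = loc (travel r (cluster z (z j)))"
      using meet by (simp add: travel_def)
    ultimately show ?thesis using r unfolding collision_times_def by force
  qed
  then show False using first[OF r(2)] by simp
qed

text \<open>Induction along the collisions: travel and merging together are one
  \<open>drift\<close>, and \<open>r\<close> accumulates the elapsed time.\<close>

lemma evolve_system:
  assumes "0 \<le> s" "barycentric r z"
  shows "\<exists>z'. evolve (system z) s = system z' \<and> barycentric (r + s) z'"
  using assms
proof (induction "system z" s arbitrary: z r rule: evolve.induct)
  case (1 s z r)
  have z: "mono_on {1..n} z" using 1 by (simp add: barycentric_def)
  show ?case
  proof (cases "collision_times (system z) s = {}")
    case True
    then have "barycentric (r + s) (drift s z)"
      using 1 z by (intro barycentric_drift mono_drift) auto
    moreover have "evolve (system z) s = system (drift s z)"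
      using True 1 by (subst evolve.simps) (simp add: travel_system)
    ultimately show ?thesis by blast
  next
    case False
    define s1 where "s1 = Min (collision_times (system z) s)"
    have "s1 \<in> collision_times (system z) s"
      unfolding s1_def using False by (intro Min_in finite_collision_times)
    then have s1: "0 < s1" "s1 \<le> s" by (auto simp: collision_times_def)
    have "q \<notin> collision_times (system z) s1" if "q < s1" for q
    proof
      assume "q \<in> collision_times (system z) s1"
      then have "q \<in> collision_times (system z) s" using s1 by (auto simp: collision_times_def)
      then have "s1 \<le> q" unfolding s1_def by (intro Min_le finite_collision_times)
      then show False using that by simp
    qed
    then have "barycentric (r + s1) (drift s1 z)"
      using 1 z s1 by (intro barycentric_drift mono_drift) auto
    moreover have "evolve (system z) s = evolve (system (drift s1 z)) (s - s1)"
      using False by (subst evolve.simps)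
        (simp add: finite_collision_times merge_collided_travel flip: s1_def)
    ultimately show ?thesis
      using 1(1)[of "drift s1 z" "r + s1"] False s1
      by (simp add: finite_collision_times merge_collided_travel flip: s1_def)
  qed
qed

end

section \<open>The initial system and its positions at time \<open>t\<close>\<close>

lemma initial_velocity_antimono:
  assumes "i \<le> j"
  shows "initial_velocity n m j \<le> initial_velocity n m i"
proof -
  have "(\<Sum>k\<in>{j+1..n}. real (m k)) \<le> (\<Sum>k\<in>{i+1..n}. real (m k))"
    using assms by (intro sum_mono2) auto
  moreover have "(\<Sum>k\<in>{1..<i}. real (m k)) \<le> (\<Sum>k\<in>{1..<j}. real (m k))"
    using assms by (intro sum_mono2) auto
  ultimately show ?thesis by (simp add: initial_velocity_def)
qed

text \<open>The mass to the right is expressed by the total and the mass to the left, the form that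
  arises on summing over unit masses.\<close>

lemma initial_velocity_eq:
  assumes "i \<in> {1..n}"
  shows "initial_velocity n m i =
    (real (\<Sum>j=1..n. m j) - 2 * real (\<Sum>j\<in>{1..<i}. m j) - real (m i)) / 2"
proof -
  have "{1..n} = {1..<i} \<union> {i} \<union> {i+1..n}" using assms by auto
  then have "(\<Sum>j=1..n. m j) = (\<Sum>j\<in>{1..<i} \<union> {i} \<union> {i+1..n}. m j)" by simp
  also have "\<dots> = (\<Sum>j\<in>{1..<i}. m j) + m i + (\<Sum>j\<in>{i+1..n}. m j)"
    by (subst sum.union_disjoint; force)+
  finally show ?thesis by (simp add: initial_velocity_def field_simps)
qed

lemma inertia_position_barycentric:
  assumes "0 \<le> t" and x: "strict_mono_on {1..n} x" and m: "\<forall>i\<in>{1..n}. m i \<ge> 1"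
  obtains z where "mono_on {1..n} z"
    "\<And>i. i \<in> {1..n} \<Longrightarrow> inertia_position n x m i t = z i"
    "\<And>j. j \<le> n \<Longrightarrow>
      0 \<le> (\<Sum>i=1..j. real (m i) * (x i + t * initial_velocity n m i - z i))"
    "\<And>j. \<lbrakk>j \<le> n; j = n \<or> z j < z (Suc j)\<rbrakk> \<Longrightarrow>
      (\<Sum>i=1..j. real (m i) * (x i + t * initial_velocity n m i - z i)) = 0"
proof -
  interpret inertia_clusters n "\<lambda>i. real (m i)" "initial_velocity n m" x
  proof
    show "0 < real (m i)" if "i \<in> {1..n}" for i using m that by fastforce
  qed (rule initial_velocity_antimono)
  have level: "level x (x i) = {i}" if "i \<in> {1..n}" for i
    using strict_mono_on_imp_inj_on[OF x] that unfolding level_def inj_on_def by blast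
  have "cluster x (x i) =
      \<lparr>labels = {i}, weight = real (m i), loc = x i, vel = initial_velocity n m i\<rparr>"
    if "i \<in> {1..n}" for i
    using level[OF that] w_pos[OF that] by (simp add: cluster_def velocity_def)
  then have init: "initial_system n x m = system x"
    unfolding initial_system_def system_def image_image by (intro image_cong) simp_all
  \<comment> \<open>At time 0 clusters and free flow coincide, so every sum vanishes.\<close>
  have "barycentric 0 x"
    using strict_mono_on_imp_mono_on[OF x] by (simp add: barycentric_def)
  then obtain z where z: "evolve (system x) t = system z" "barycentric t z"
    using evolve_system[of t 0 x] assms(1) by auto
  show ?thesis
  proof (rule that[of z])
    show "inertia_position n x m i t = z i" if "i \<in> {1..n}" for i
      by (simp add: inertia_position_def init z(1) the_cluster[OF that])
    show "(\<Sum>i=1..j. real (m i) * (x i + t * initial_velocity n m i - z i)) = 0"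
      if "j \<le> n" "j = n \<or> z j < z (Suc j)" for j
    proof -
      have "cluster_end z j" using that by (auto simp: cluster_end_def)
      then show ?thesis using z(2) that(1) unfolding barycentric_def by blast
    qed
  qed (use z(2) in \<open>unfold barycentric_def, blast+\<close>)
qed

section \<open>Blocks in increasing order\<close>

text \<open>The minima of sorted nonempty blocks increase strictly, so both lists have the same list
  of minima; a block is recovered from its minimum by disjointness.\<close>

lemma sorted_blocks_unique:
  fixes bs cs :: "nat set list"
  assumes "set bs = set cs"
    and bs: "sorted_wrt (\<lambda>A B. \<forall>i\<in>A. \<forall>j\<in>B. i < j) bs"
    and cs: "sorted_wrt (\<lambda>A B. \<forall>i\<in>A. \<forall>j\<in>B. i < j) cs"
    and ne: "\<And>B. B \<in> set cs \<Longrightarrow> finite B \<and> B \<noteq> {}"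
    and disj: "\<And>B C. \<lbrakk>B \<in> set cs; C \<in> set cs; B \<inter> C \<noteq> {}\<rbrakk> \<Longrightarrow> B = C"
  shows "bs = cs"
proof -
  have sorted_Min: "sorted_wrt (<) (map Min ds)"
    if "sorted_wrt (\<lambda>A B. \<forall>i\<in>A. \<forall>j\<in>B. i < j) ds" "set ds = set cs" for ds
    unfolding sorted_wrt_map
    by (rule sorted_wrt_mono_rel[OF _ that(1)]) (use ne that(2) in simp)
  have "map Min bs = map Min cs"
    using sorted_Min[OF bs] sorted_Min[OF cs] assms(1)
    by (intro strict_sorted_equal) auto
  moreover have "inj_on Min (set bs \<union> set cs)"
  proof (rule inj_onI)
    fix B C assume "B \<in> set bs \<union> set cs" "C \<in> set bs \<union> set cs" "Min B = Min C"
    moreover from this have "Min B \<in> B" "Min C \<in> C" using assms(1) ne Min_in by blast+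
    ultimately show "B = C" using disj assms(1) by auto
  qed
  ultimately show ?thesis by (rule map_inj_on)
qed

lemma cluster_blocks_eq:
  assumes z: "mono_on {1..n} z"
    and pos: "\<And>i. i \<in> {1..n} \<Longrightarrow> inertia_position n x m i t = z i"
  shows "cluster_blocks n x m t =
    map (\<lambda>y. {i \<in> {1..n}. z i = y}) (sorted_list_of_set (z ` {1..n}))"
proof -
  let ?L = "\<lambda>y. {i \<in> {1..n}. z i = y}"
  let ?bs = "map ?L (sorted_list_of_set (z ` {1..n}))"
  have "cluster_partition n x m t = (\<lambda>i. ?L (z i)) ` {1..n}"
  proof -
    have "{(i, j) \<in> {1..n} \<times> {1..n}. inertia_position n x m i t = inertia_position n x m j t} `` {i} =
        ?L (z i)" if "i \<in> {1..n}" for i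
      using pos that by fastforce
    then show ?thesis unfolding cluster_partition_def quotient_def by blast
  qed
  then have set_bs: "set ?bs = cluster_partition n x m t" by (simp add: image_image)
  have less: "i < j" if "i \<in> {1..n}" "j \<in> {1..n}" "z i < z j" for i j
    using mono_onD[OF z, of j i] that by force
  have sorted_bs: "sorted_wrt (\<lambda>A B. \<forall>i\<in>A. \<forall>j\<in>B. i < j) ?bs"
    unfolding sorted_wrt_map
    by (rule sorted_wrt_mono_rel[OF _ strict_sorted_list_of_set]) (use less in blast)
  have "bs = ?bs" if "set bs = cluster_partition n x m t"
    "sorted_wrt (\<lambda>A B. \<forall>i\<in>A. \<forall>j\<in>B. i < j) bs" for bs
  proof (rule sorted_blocks_unique)
    show "set bs = set ?bs" using that set_bs by simp
  qed (use that sorted_bs in auto)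
  then show ?thesis
    unfolding cluster_blocks_def using set_bs sorted_bs by (intro the_equality) blast+
qed

text \<open>Reduces the case distinction of the theorem to equality of positions.\<close>

lemma same_block_iff:
  assumes z: "mono_on {1..n} z"
    and pos: "\<And>i. i \<in> {1..n} \<Longrightarrow> inertia_position n x m i t = z i"
    and ik: "i \<in> {1..n}" "k \<in> {1..n}"
  shows "(\<exists>j\<in>{1..num_clusters n x m t}.
      i \<in> cluster_block n x m t j \<and> k \<in> cluster_block n x m t j) \<longleftrightarrow> z i = z k"
proof -
  let ?ys = "sorted_list_of_set (z ` {1..n})"
  let ?bs = "cluster_blocks n x m t"
  have blocks: "?bs = map (\<lambda>y. {i \<in> {1..n}. z i = y}) ?ys"
    by (rule cluster_blocks_eq[OF z]) (rule pos)
  have "(\<lambda>i. inertia_position n x m i t) ` {1..n} = z ` {1..n}"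
    by (intro image_cong refl pos)
  then have "num_clusters n x m t = length ?bs"
    by (simp add: num_clusters_def blocks del: One_nat_def)
  then have "(\<exists>j\<in>{1..num_clusters n x m t}.
      i \<in> cluster_block n x m t j \<and> k \<in> cluster_block n x m t j) \<longleftrightarrow>
    (\<exists>j<length ?bs. i \<in> ?bs ! j \<and> k \<in> ?bs ! j)"
    \<comment> \<open>Block number \<open>j\<close> is list position \<open>j - 1\<close>;
      \<open>Suc\<close> shifts back.\<close>
    by (auto simp: cluster_block_def Bex_def intro: exI[of _ "Suc _"])
      (metis Suc_le_eq Suc_pred diff_Suc_1 le_simps(3) zero_less_Suc)+
  also have "\<dots> \<longleftrightarrow> (\<exists>B\<in>set ?bs. i \<in> B \<and> k \<in> B)"
    by (metis in_set_conv_nth)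
  also have "\<dots> \<longleftrightarrow> z i = z k"
    using ik unfolding blocks by auto
  finally show ?thesis .
qed

section \<open>The quadratic program\<close>

lemma mass_index_eq:
  assumes "j \<in> {1..n}" "(\<Sum>l\<in>{1..<j}. m l) < k" "k \<le> (\<Sum>l\<in>{1..j}. m l)"
  shows "mass_index n m k = j"
  unfolding mass_index_def
proof (rule the_equality)
  fix i assume i: "i \<in> {1..n} \<and> (\<Sum>l\<in>{1..<i}. m l) < k \<and> k \<le> (\<Sum>l\<in>{1..i}. m l)"
  have le: "(\<Sum>l\<in>{1..a}. m l) \<le> (\<Sum>l\<in>{1..<b}. m l)" if "a < b" for a b
    using that by (intro sum_mono2) auto
  show "i = j"
    using le[of i j] le[of j i] i assms by (cases i j rule: linorder_cases) auto
qed (use assms in blast)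

lemma mass_index_props:
  assumes "k \<in> {1..(\<Sum>l=1..n. m l)}"
  shows "mass_index n m k \<in> {1..n}"
    and "(\<Sum>l\<in>{1..<mass_index n m k}. m l) < k"
    and "k \<le> (\<Sum>l\<in>{1..mass_index n m k}. m l)"
proof -
  \<comment> \<open>Minimality gives the strict lower bound; \<open>1 \<le> k\<close> excludes
    \<open>j = 0\<close>.\<close>
  define j where "j = (LEAST j. k \<le> (\<Sum>l=1..j. m l))"
  have j: "k \<le> (\<Sum>l=1..j. m l)" "j \<le> n"
    unfolding j_def using assms by (auto intro: LeastI Least_le)
  then have "j \<noteq> 0" using assms by (intro notI) simp
  then have "\<not> k \<le> (\<Sum>l=1..j - 1. m l)"
    unfolding j_def by (intro not_less_Least) (simp add: j_def)
  moreover have "{1..j - 1} = {1..<j}" using \<open>j \<noteq> 0\<close> by auto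
  ultimately have j': "j \<in> {1..n}" "(\<Sum>l\<in>{1..<j}. m l) < k"
    using j \<open>j \<noteq> 0\<close> by auto
  then have "mass_index n m k = j" using j(1) by (rule mass_index_eq)
  then show "mass_index n m k \<in> {1..n}" "(\<Sum>l\<in>{1..<mass_index n m k}. m l) < k"
    "k \<le> (\<Sum>l\<in>{1..mass_index n m k}. m l)" using j j' by simp_all
qed

lemma sum_affine_block:
  fixes c t :: real
  shows "(\<Sum>k\<in>{a<..a + b}. c - t * real k) =
    real b * (c - t * (2 * real a + real b + 1) / 2)"
proof (induction b)
  case (Suc b)
  have "{a<..a + Suc b} = insert (a + Suc b) {a<..a + b}" by auto
  with Suc show ?case by (simp add: field_simps)
qed simp

section \<open>Optimality conditions\<close>

text \<open>The exact Taylor expansion at \<open>a\<close>, with gradient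
  \<open>t * a k + u k\<close>.\<close>

lemma objective_expansion:
  "objective M t u b = objective M t u a + (\<Sum>k=1..M. (t * a k + u k) * (b k - a k))
    + t / 2 * (\<Sum>k=1..M. (b k - a k)\<^sup>2)"
proof -
  have "t / 2 * (b k)\<^sup>2 + u k * b k = t / 2 * (a k)\<^sup>2 + u k * a k
      + (t * a k + u k) * (b k - a k) + t / 2 * (b k - a k)\<^sup>2" for k
    by (simp add: power2_eq_square field_simps)
  then show ?thesis
    unfolding objective_def sum_distrib_left sum.distrib[symmetric] by (intro sum.cong) auto
qed

text \<open>The hypotheses on the partial sums of the gradient are the Karush--Kuhn--Tucker conditions.\<close>

lemma is_arg_min_objective_iff:
  assumes t: "0 < t" and M: "1 \<le> M" and a: "a \<in> feasible M"
    and nonneg: "\<And>k. k \<in> {1..M} \<Longrightarrow> 0 \<le> (\<Sum>l=1..k. t * a l + u l)"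
    and total: "(\<Sum>l=1..M. t * a l + u l) = 0"
    and slack: "\<And>k. \<lbrakk>k \<in> {1..<M}; a k - a (Suc k) \<noteq> 1\<rbrakk> \<Longrightarrow> (\<Sum>l=1..k. t * a l + u l) = 0"
  shows "is_arg_min (objective M t u) (\<lambda>a. a \<in> feasible M) b \<longleftrightarrow> b = a"
proof -
  have bound: "objective M t u a + t / 2 * (\<Sum>k=1..M. (b k - a k)\<^sup>2) \<le> objective M t u b"
    if b: "b \<in> feasible M" for b
  proof -
    obtain N where N: "M = Suc N" using M by (cases M) auto
    define d where "d k = b k - a k" for k
    \<comment> \<open>Complementary slackness: where the constraint is tight for \<open>a\<close>,
      feasibility of \<open>b\<close> makes the second factor nonnegative; elsewhere the multiplier
      is 0.\<close>
    have "0 \<le> (\<Sum>l=1..k. t * a l + u l) * (d k - d (Suc k))" if "k \<in> {1..N}" for k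
    proof (cases "a k - a (Suc k) = 1")
      case True
      have "b k - b (Suc k) \<ge> 1" using b that N by (simp add: feasible_def)
      then show ?thesis using True nonneg[of k] that N by (intro mult_nonneg_nonneg) (simp_all add: d_def)
    qed (use slack[of k] that N in simp)
    then have "0 \<le> (\<Sum>k=1..N. (\<Sum>l=1..k. t * a l + u l) * (d k - d (Suc k)))"
      by (rule sum_nonneg)
    then have "0 \<le> (\<Sum>k=1..M. (t * a k + u k) * d k)"
      using total unfolding N summation_by_parts_Suc by simp
    then show ?thesis unfolding objective_expansion[of M t u b a] by (simp add: d_def)
  qed
  have strict: "objective M t u a < objective M t u b" if "b \<in> feasible M" "b \<noteq> a" for b
  proof -
    \<comment> \<open>Both are \<open>undefined\<close> outside \<open>{1..M}\<close>, so they
      differ inside it.\<close>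
    have "\<exists>k\<in>{1..M}. b k \<noteq> a k"
      using that a PiE_ext[of b "{1..M}" "\<lambda>_. UNIV" a] unfolding feasible_def by blast
    then obtain k where "b k \<noteq> a k" "k \<in> {1..M}" by blast
    then have "0 < (\<Sum>k=1..M. (b k - a k)\<^sup>2)" by (intro sum_pos2[of _ k]) auto
    then have "0 < t / 2 * (\<Sum>k=1..M. (b k - a k)\<^sup>2)" using t by simp
    then show ?thesis using bound[OF that(1)] by linarith
  qed
  show ?thesis
    unfolding is_arg_min_def using a strict by (metis order.asym)
qed

section \<open>From initial masses to unit masses\<close>

text \<open>The index changes only after the last unit of a mass, and then by exactly one because
  the next mass has at least one unit.\<close>

lemma mass_index_Suc:
  assumes k: "k \<in> {1..<(\<Sum>l=1..n. m l)}" and m: "\<forall>i\<in>{1..n}. m i \<ge> 1"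
  shows "mass_index n m (Suc k) = mass_index n m k \<or>
    mass_index n m (Suc k) = Suc (mass_index n m k) \<and> mass_index n m k < n \<and>
      k = (\<Sum>l=1..mass_index n m k. m l)"
proof -
  define j where "j = mass_index n m k"
  have j: "j \<in> {1..n}" "(\<Sum>l\<in>{1..<j}. m l) < k" "k \<le> (\<Sum>l\<in>{1..j}. m l)"
    using mass_index_props[of k m n] k by (auto simp: j_def)
  show ?thesis
  proof (cases "k = (\<Sum>l=1..j. m l)")
    case True
    then have "j \<noteq> n" using k by auto
    then have "j < n" using j(1) by simp
    then have "m (Suc j) \<ge> 1" using m by simp
    moreover have "{1..<Suc j} = {1..j}" by auto
    ultimately have "mass_index n m (Suc k) = Suc j"
      using True \<open>j < n\<close> by (intro mass_index_eq) simp_all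
    then show ?thesis using True \<open>j < n\<close> unfolding j_def by blast
  next
    case False
    then have "Suc k \<le> (\<Sum>l=1..j. m l)" using j(3) by linarith
    moreover have "(\<Sum>l\<in>{1..<j}. m l) < Suc k" using j(2) by linarith
    ultimately have "mass_index n m (Suc k) = j" using j(1) by (intro mass_index_eq)
    then show ?thesis by (simp add: j_def)
  qed
qed

text \<open>The summand is the gradient at the candidate minimizer. Over the units of mass
  \<open>i\<close> the mean of \<open>(M + 1) / 2 - k\<close> is the initial velocity of
  \<open>i\<close>, so the sums up to the last unit of a mass are the barycentre sums.\<close>

lemma sum_over_masses:
  fixes z x :: "nat \<Rightarrow> real" and m :: "nat \<Rightarrow> nat"
  assumes "j \<le> n" and M: "M = (\<Sum>i=1..n. m i)"
  shows "(\<Sum>k=1..(\<Sum>l=1..j. m l).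
      t * (real M + 1) / 2 - t * real k + (x (mass_index n m k) - z (mass_index n m k))) =
    (\<Sum>i=1..j. real (m i) * (x i + t * initial_velocity n m i - z i))"
  using assms(1)
proof (induction j)
  case (Suc j)
  let ?S = "\<Sum>l=1..j. m l"
  let ?g = "\<lambda>k. t * (real M + 1) / 2 - t * real k + (x (mass_index n m k) - z (mass_index n m k))"
  have lt: "{1..<Suc j} = {1..j}" by auto
  have index: "mass_index n m k = Suc j" if "k \<in> {?S<..?S + m (Suc j)}" for k
    using that Suc.prems by (intro mass_index_eq) (simp_all add: lt del: sum.op_ivl_Suc One_nat_def)
  have "{1..(\<Sum>l=1..Suc j. m l)} = {1..?S} \<union> {?S<..?S + m (Suc j)}" by auto
  then have "(\<Sum>k=1..(\<Sum>l=1..Suc j. m l). ?g k) =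
      (\<Sum>k=1..?S. ?g k) + (\<Sum>k\<in>{?S<..?S + m (Suc j)}. ?g k)"
    by (simp only:, subst sum.union_disjoint) auto
  also have "(\<Sum>k\<in>{?S<..?S + m (Suc j)}. ?g k) =
      (\<Sum>k\<in>{?S<..?S + m (Suc j)}. (t * (real M + 1) / 2 + (x (Suc j) - z (Suc j))) - t * real k)"
    by (intro sum.cong) (simp_all add: index)
  also have "\<dots> = real (m (Suc j)) *
      (x (Suc j) + t * initial_velocity n m (Suc j) - z (Suc j))"
    unfolding sum_affine_block
    using Suc.prems by (simp add: initial_velocity_eq lt M field_simps del: of_nat_sum sum.op_ivl_Suc One_nat_def)
  finally show ?case using Suc by simp
qed simp

theorem corollary1p3:
  fixes n M :: nat and t :: real and x u :: "nat \<Rightarrow> real" and m f :: "nat \<Rightarrow> nat"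
  assumes "n \<ge> 1" and "t > 0"
    and "strict_mono_on {1..n} x"
    and "\<forall>i\<in>{1..n}. m i \<ge> 1"
    and "M = (\<Sum>i=1..n. m i)"
    and "\<forall>k\<in>{1..M}. f k = mass_index n m k"
    and "\<forall>k\<in>{1..M}. u k = x (f k)"
  shows "(\<exists>!a. is_arg_min (objective M t u) (\<lambda>a. a \<in> feasible M) a) \<and>
    (\<forall>a. is_arg_min (objective M t u) (\<lambda>a. a \<in> feasible M) a \<longrightarrow>
      (\<forall>i\<in>{1..<M}.
        ((\<exists>j\<in>{1..num_clusters n x m t}.
            f i \<in> cluster_block n x m t j \<and> f (i + 1) \<in> cluster_block n x m t j)
          \<longrightarrow> a i - a (i + 1) = 1) \<and>
        (\<not> (\<exists>j\<in>{1..num_clusters n x m t}.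
            f i \<in> cluster_block n x m t j \<and> f (i + 1) \<in> cluster_block n x m t j)
          \<longrightarrow> a i - a (i + 1) > 1)))"
proof -
  have f: "f k = mass_index n m k" if "k \<in> {1..M}" for k using assms(6) that by blast
  have index: "f k \<in> {1..n}" "(\<Sum>l\<in>{1..<f k}. m l) < k" "k \<le> (\<Sum>l\<in>{1..f k}. m l)"
    if "k \<in> {1..M}" for k
    using mass_index_props[of k m n] that f[OF that] assms(5) by simp_all
  have index_Suc: "f (Suc k) = f k \<or>
      f (Suc k) = Suc (f k) \<and> f k < n \<and> k = (\<Sum>l=1..f k. m l)" if "k \<in> {1..<M}" for k
    using mass_index_Suc[of k m n] that f[of k] f[of "Suc k"] assms(4,5) by simp
  have "m 1 \<ge> 1" using assms(1,4) by simp
  then have "0 < M" using assms(1,5) by (simp add: sum_pos2[of _ 1])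
  obtain z where z: "mono_on {1..n} z"
    and pos: "\<And>i. i \<in> {1..n} \<Longrightarrow> inertia_position n x m i t = z i"
    and prefix: "\<And>j. j \<le> n \<Longrightarrow>
      0 \<le> (\<Sum>i=1..j. real (m i) * (x i + t * initial_velocity n m i - z i))"
    and prefix_end: "\<And>j. \<lbrakk>j \<le> n; j = n \<or> z j < z (Suc j)\<rbrakk> \<Longrightarrow>
      (\<Sum>i=1..j. real (m i) * (x i + t * initial_velocity n m i - z i)) = 0"
    using inertia_position_barycentric[of t n x m] assms(2-4) by auto
  define a where "a = (\<lambda>k\<in>{1..M}. (real M + 1) / 2 - real k - z (f k) / t)"
  have step: "a k - a (Suc k) = 1 + (z (f (Suc k)) - z (f k)) / t" if "k \<in> {1..<M}" for k
    using that by (simp add: a_def diff_divide_distrib)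
  have z_le: "z (f k) \<le> z (f (Suc k))" if "k \<in> {1..<M}" for k
    using index_Suc[OF that] index(1)[of k] that by (intro mono_onD[OF z]) auto
  have feasible: "a \<in> feasible M"
    using step z_le assms(2) by (simp add: feasible_def) (simp add: a_def)
  \<comment> \<open>The gradient at \<open>a\<close>; its partial sums are the multipliers.\<close>
  define g where "g k = t * a k + u k" for k
  have g: "g k = t * (real M + 1) / 2 - t * real k + (x (f k) - z (f k))"
    if "k \<in> {1..M}" for k
    using that assms(2,7) by (simp add: g_def a_def field_simps)
  have S_le: "(\<Sum>l=1..j. m l) \<le> M" if "j \<le> n" for j
    unfolding assms(5) using that by (intro sum_mono2) auto
  have sum_g: "(\<Sum>k=1..(\<Sum>l=1..j. m l). g k) =
      (\<Sum>i=1..j. real (m i) * (x i + t * initial_velocity n m i - z i))" if "j \<le> n" for j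
    unfolding sum_over_masses[OF that assms(5), symmetric]
    using S_le[OF that] by (intro sum.cong refl) (simp add: g f)
  have nonneg: "0 \<le> (\<Sum>l=1..k. g l)" if k: "k \<in> {1..M}" for k
  proof -
    define j where "j = f k"
    have j: "j \<in> {1..n}" "(\<Sum>l\<in>{1..<j}. m l) < k" "k \<le> (\<Sum>l=1..j. m l)"
      using index[OF k] by (simp_all add: j_def)
    have lt: "{1..<j} = {1..j - 1}" using j(1) by auto
    \<comment> \<open>Over the units of mass \<open>j\<close> the gradient falls by \<open>t\<close>
      per step, so the values at the two boundaries of the mass bound the multipliers between
      them.\<close>
    show ?thesis
    proof (rule unimodal_prefix_sum_nonneg)
      show "(\<Sum>l=1..j - 1. m l) \<le> k" "k \<le> (\<Sum>l=1..j. m l)" using j lt by simp_all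
    next
      fix i l
      assume il: "(\<Sum>l=1..j - 1. m l) < i" "i \<le> l" "l \<le> (\<Sum>l=1..j. m l)" "0 \<le> g l"
      have range: "i \<in> {1..M}" "l \<in> {1..M}" using il S_le[of j] j(1) by auto
      have "f i = j" "f l = j"
        unfolding f[OF range(1)] f[OF range(2)]
        using il j(1) by (intro mass_index_eq; simp add: lt del: One_nat_def)+
      moreover have "t * real i \<le> t * real l" using il(2) assms(2) by simp
      ultimately show "0 \<le> g i" using il(4) range by (simp add: g)
    next
      show "0 \<le> (\<Sum>i=1..(\<Sum>l=1..j - 1. m l). g i)" "0 \<le> (\<Sum>i=1..(\<Sum>l=1..j. m l). g i)"
        using sum_g[of "j - 1"] sum_g[of j] prefix[of "j - 1"] prefix[of j] j(1)
        by (simp_all add: le_diff_conv)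
    qed
  qed
  have arg_min: "is_arg_min (objective M t u) (\<lambda>a. a \<in> feasible M) b \<longleftrightarrow> b = a" for b
  proof (rule is_arg_min_objective_iff[OF assms(2) _ feasible, where u = u, folded g_def])
    show "(\<Sum>l=1..M. g l) = 0"
      using sum_g[of n] prefix_end[of n] assms(5) by simp
  next
    fix k assume k: "k \<in> {1..<M}" "a k - a (Suc k) \<noteq> 1"
    define j where "j = f k"
    \<comment> \<open>A constraint is slack only where \<open>z\<close> jumps: \<open>k\<close> is
      then the last unit of mass \<open>j\<close>, and \<open>j\<close> ends its cluster.\<close>
    have "z (f k) \<noteq> z (f (Suc k))" using step[OF k(1)] k(2) by auto
    then have "z (f k) < z (f (Suc k))" "f k \<noteq> f (Suc k)" using z_le[OF k(1)] by auto
    then have kj: "k = (\<Sum>l=1..j. m l)" and j: "j \<le> n" "z j < z (Suc j)"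
      using index_Suc[OF k(1)] unfolding j_def by (metis less_imp_le)+
    have "(\<Sum>l=1..(\<Sum>l=1..j. m l). g l) = 0"
      using sum_g[OF j(1)] prefix_end[OF j(1) disjI2[OF j(2)]] by (rule trans)
    then show "(\<Sum>l=1..k. g l) = 0" by (simp only: kj)
  qed (use \<open>0 < M\<close> nonneg in auto)
  have block: "(\<exists>j\<in>{1..num_clusters n x m t}.
      f k \<in> cluster_block n x m t j \<and> f (k + 1) \<in> cluster_block n x m t j) \<longleftrightarrow>
    z (f k) = z (f (Suc k))" if "k \<in> {1..<M}" for k
    using same_block_iff[OF z pos, of "f k" "f (Suc k)"] index(1)[of k] index(1)[of "Suc k"] that
    by simp
  have "1 < a k - a (k + 1)" if "k \<in> {1..<M}" "z (f k) \<noteq> z (f (Suc k))" for k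
    using step[OF that(1)] z_le[OF that(1)] that(2) assms(2) by simp
  moreover have "a k - a (k + 1) = 1" if "k \<in> {1..<M}" "z (f k) = z (f (Suc k))" for k
    using step[OF that(1)] that(2) by simp
  ultimately show ?thesis unfolding arg_min using block by simp
qed

end
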